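(* Let $\mathbf X$ be a zero-mean Gaussian random vector in $\mathbb R^n$ with covariance matrix $\Sigma$. The following concerns the exactness of the bounds $$e^{-t^2\langle\mathbf u,\Sigma^{-1}\mathbf u\rangle/2}\le\frac{\mathsf E\,w(\mathbf X-t\mathbf u)}{\mathsf E\,w(\mathbf X)}\le r_{t\|\Sigma^{-1/2}\mathbf u\|}(a_{\Sigma,w,\mathbf u}),$$ which hold for all even unimodal functions $w\colon\mathbb R^n\to[0,\infty)$ with $\mathsf E\,w(\mathbf X)>0$, all unit vectors $\mathbf u\in\mathbb R^n$, and all real $t\ge0$. (i) For any positive-definite symmetric matrix $\Sigma$, any unit vector $\mathbf u\in\mathbb R^n$, and any real $t\ge0$, the lower bound $e^{-t^2\langle\mathbf u,\Sigma^{-1}\mathbf u\rangle/2}$ on the ratio $\mathsf E\,w(\mathbf X-t\mathbf u)/\mathsf E\,w(\mathbf X)$ cannot be replaced by any strictly greater number. (ii) For any positive-definite symmetric matrix $\Sigma$, any unit vector $\mathbf u\in\mathbb R^n$, any real $t\ge0$, and any $a\in[0,\infty]$, there is an even unimodal function $w\colon\mathbb R^n\to[0,\infty)$ such that $a_{\Sigma,w,\mathbf u}=a$ and the upper bound is attained, that is, $$\frac{\mathsf E\,w(\mathbf X-t\mathbf u)}{\mathsf E\,w(\mathbf X)}=r_{t\|\Sigma^{-1/2}\mathbf u\|}(a_{\Sigma,w,\mathbf u}).$$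
   Context: $\langle\cdot,\cdot\rangle$ and $\|\cdot\|$ are the standard inner product and the Euclidean norm on $\mathbb R^n$; $\Sigma^{-1/2}$ is the inverse of the symmetric positive-definite square root of $\Sigma$. A function $w\colon\mathbb R^n\to[0,\infty)$ is even if $w(-\mathbf x)=w(\mathbf x)$ for all $\mathbf x$, and unimodal if the set $\{\mathbf x\in\mathbb R^n\colon w(\mathbf x)>c\}$ is convex for each real $c$. Unless otherwise stated, the functions $w$ are assumed to satisfy $\mathsf E\,w(\mathbf X)>0$. The support function of a set $A\subseteq\mathbb R^n$ is $\delta^*(\mathbf v|A):=\sup\{\langle\mathbf z,\mathbf v\rangle\colon\mathbf z\in A\}$. Further, $A_w:=\{\mathbf x\in\mathbb R^n\colon w(\mathbf x)>0\}$ and $a_{\Sigma,w,\mathbf u}:=\dfrac{\delta^*(\Sigma^{-1}\mathbf u\,|\,A_w)}{\|\Sigma^{-1/2}\mathbf u\|}\in[0,\infty]$. $\Phi$ is the standard normal cumulative distribution function on $\mathbb R$. For $t\in[0,\infty)$ and $a\in[0,\infty]$, $r_t(a):=e^{-t^2/2}$ if $a=0$; $r_t(a):=\dfrac{\Phi(t+a)-\Phi(t-a)}{\Phi(a)-\Phi(-a)}$ if $a\in(0,\infty)$; $r_t(a):=1$ if $a=\infty$.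
   Formalization: In (ii), a = 0 is excluded, since a_{Σ,w,u} = 0 forces E w(X) = 0; instead it is shown that even unimodal functions attaining the upper bound exist with a_{Σ,w,u} → 0 and ratios tending to r_{t‖Σ^{-1/2}u‖}(0). *)

theory Defs
  imports "HOL-Probability.Probability"
begin

section \<open>Gaussian random vectors\<close>

text \<open>A constant is a (degenerate) Gaussian random variable.\<close>

definition gaussian_rv :: "'a measure \<Rightarrow> ('a \<Rightarrow> real) \<Rightarrow> bool" where
  "gaussian_rv M Y \<longleftrightarrow>
     Y \<in> borel_measurable M \<and>
     ((\<exists>\<mu> \<sigma>. 0 < \<sigma> \<and> distributed M lborel Y (normal_density \<mu> \<sigma>)) \<or>
      (\<exists>\<mu>. AE \<omega> in M. Y \<omega> = \<mu>))"

definition gaussian_vector :: "'a measure \<Rightarrow> ('a \<Rightarrow> real ^ 'n) \<Rightarrow> bool" where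
  "gaussian_vector M X \<longleftrightarrow>
     X \<in> borel_measurable M \<and> (\<forall>v. gaussian_rv M (\<lambda>\<omega>. v \<bullet> X \<omega>))"

definition covariance_matrix :: "'a measure \<Rightarrow> ('a \<Rightarrow> real ^ 'n) \<Rightarrow> real ^ 'n ^ 'n" where
  "covariance_matrix M X =
     (\<chi> i j. LINT \<omega>|M. (X \<omega> $ i - (LINT \<omega>'|M. X \<omega>' $ i)) * (X \<omega> $ j - (LINT \<omega>'|M. X \<omega>' $ j)))"

text \<open>
  A set \<open>{x. w x > c}\<close> that is convex is Lebesgue measurable but not necessarily Borel, so for an
  even unimodal \<open>w\<close> the variable \<open>w (X - y)\<close> need not be measurable with respect to \<open>M\<close> itself.
  If \<open>X\<close> has a nondegenerate Gaussian law, it is measurable (and bounded) with respect to the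
  completion of \<open>M\<close>. For \<open>M\<close>-measurable \<open>f\<close> this is the usual expectation.
\<close>

definition expect :: "'a measure \<Rightarrow> ('a \<Rightarrow> real) \<Rightarrow> real" where
  "expect M f = (LINT \<omega>|completion M. f \<omega>)"


section \<open>Positive-definite matrices\<close>

definition pos_def :: "real ^ 'n ^ 'n \<Rightarrow> bool" where
  "pos_def A \<longleftrightarrow> transpose A = A \<and> (\<forall>x. x \<noteq> 0 \<longrightarrow> 0 < x \<bullet> (A *v x))"

definition matrix_sqrt :: "real ^ 'n ^ 'n \<Rightarrow> real ^ 'n ^ 'n" where
  "matrix_sqrt A = (THE B. pos_def B \<and> B ** B = A)"

definition matrix_inv_sqrt :: "real ^ 'n ^ 'n \<Rightarrow> real ^ 'n ^ 'n" where
  "matrix_inv_sqrt A = matrix_inv (matrix_sqrt A)"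


section \<open>Even unimodal functions\<close>

definition even_fun :: "(real ^ 'n \<Rightarrow> real) \<Rightarrow> bool" where
  "even_fun w \<longleftrightarrow> (\<forall>x. w (- x) = w x)"

definition unimodal :: "(real ^ 'n \<Rightarrow> real) \<Rightarrow> bool" where
  "unimodal w \<longleftrightarrow> (\<forall>c. convex {x. w x > c})"

definition admissible :: "'a measure \<Rightarrow> ('a \<Rightarrow> real ^ 'n) \<Rightarrow> (real ^ 'n \<Rightarrow> real) \<Rightarrow> bool" where
  "admissible M X w \<longleftrightarrow>
     (\<forall>x. 0 \<le> w x) \<and> even_fun w \<and> unimodal w \<and> 0 < expect M (\<lambda>\<omega>. w (X \<omega>))"

definition shift_ratio ::
  "'a measure \<Rightarrow> ('a \<Rightarrow> real ^ 'n) \<Rightarrow> (real ^ 'n \<Rightarrow> real) \<Rightarrow> real ^ 'n \<Rightarrow> real \<Rightarrow> real" where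
  "shift_ratio M X w u t =
     expect M (\<lambda>\<omega>. w (X \<omega> - t *\<^sub>R u)) / expect M (\<lambda>\<omega>. w (X \<omega>))"


section \<open>The quantities in the upper bound\<close>

definition support_fun :: "real ^ 'n \<Rightarrow> (real ^ 'n) set \<Rightarrow> ereal" where
  "support_fun v A = (SUP z\<in>A. ereal (z \<bullet> v))"

definition half_width :: "real ^ 'n ^ 'n \<Rightarrow> (real ^ 'n \<Rightarrow> real) \<Rightarrow> real ^ 'n \<Rightarrow> ereal" where
  "half_width S w u =
     support_fun (matrix_inv S *v u) {x. w x > 0} / ereal (norm (matrix_inv_sqrt S *v u))"

text \<open>
  For admissible \<open>w\<close> the half-width is never \<open>0\<close>: otherwise \<open>{x. w x > 0}\<close>, being symmetric, would lie
  in a hyperplane, which is a null set for a nondegenerate Gaussian law, and \<open>w (X)\<close> would have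
  expectation \<open>0\<close>. The value of \<open>upper_ratio\<close> at \<open>0\<close> is the limit from the right.
\<close>

definition std_normal_cdf :: "real \<Rightarrow> real" where
  "std_normal_cdf = cdf std_normal_distribution"

definition upper_ratio :: "real \<Rightarrow> ereal \<Rightarrow> real" where
  "upper_ratio t a =
     (if a = 0 then exp (- (t\<^sup>2) / 2)
      else if a = \<infinity> then 1
      else (std_normal_cdf (t + real_of_ereal a) - std_normal_cdf (t - real_of_ereal a)) /
           (std_normal_cdf (real_of_ereal a) - std_normal_cdf (- real_of_ereal a)))"

end

theory Submission
  imports Defs
begin

text \<open>
  All three claims come from one family of functions: the indicators of the slabs
  \<open>{x. \<bar>v \<bullet> x\<bar> \<le> a * s}\<close> with \<open>v = \<Sigma>\<^sup>-\<^sup>1 u\<close> and \<open>s\<close> the norm of \<open>\<Sigma>\<^sup>-\<^sup>1\<^sup>/\<^sup>2 u\<close>. A slab only sees the random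
  variable \<open>v \<bullet> X\<close>, which is centred normal with variance \<open>v \<bullet> \<Sigma> v = u \<bullet> \<Sigma>\<^sup>-\<^sup>1 u = s\<^sup>2\<close>, so that
  \<open>Z = (v \<bullet> X) / s\<close> is standard normal. Since \<open>(v \<bullet> t u) / s = t s\<close>,
  shifting \<open>X\<close> by \<open>t u\<close> turns the event \<open>\<bar>Z\<bar> \<le> a\<close> into \<open>\<bar>Z - t s\<bar> \<le> a\<close>, and the ratio of the two
  probabilities is exactly the upper bound at half-width \<open>a\<close> (\<open>expect_slab_shift\<close>). The half-width of
  the slab is \<open>a\<close> (\<open>support_fun_slab\<close>); infinite half-width is attained by the constant function \<open>1\<close>.

  As \<open>a\<close> tends to \<open>0\<close>, this ratio tends to the quotient of the normal densities at \<open>t s\<close> and at \<open>0\<close>,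
  that is, to \<open>exp (- (t s)\<^sup>2 / 2)\<close> (\<open>upper_ratio_tendsto_0\<close>). This gives the limiting case of zero
  half-width; and as the limit is the lower bound \<open>exp (- t\<^sup>2 (u \<bullet> \<Sigma>\<^sup>-\<^sup>1 u) / 2)\<close>, the same thin slabs
  show that the lower bound is sharp.

  The identity \<open>s\<^sup>2 = u \<bullet> \<Sigma>\<^sup>-\<^sup>1 u\<close> requires that the positive-definite square root exists and is unique
  (\<open>pos_def_matrix_sqrt\<close>). Both follow from the spectral theorem for symmetric maps
  (\<open>symmetric_linear_eigenbasis\<close>).
\<close>

section \<open>Square roots of positive-definite maps\<close>

text \<open>
  The Rayleigh quotient \<open>x \<bullet> f x\<close> attains its maximum \<open>l\<close> on the unit sphere of \<open>V\<close> at some \<open>e\<close>. Were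
  \<open>z = f e - l e\<close> nonzero, then a small step from \<open>e\<close> in the direction \<open>z\<close> would increase it to
  first order.
\<close>

lemma symmetric_linear_has_eigenvector:
  fixes f :: "'e::euclidean_space \<Rightarrow> 'e"
  assumes lin: "linear f" and sym: "\<And>x y. x \<bullet> f y = f x \<bullet> y"
    and V: "subspace V" "\<And>x. x \<in> V \<Longrightarrow> f x \<in> V" and y: "y \<in> V" "y \<noteq> 0"
  obtains e where "e \<in> V" "norm e = 1" "f e = (e \<bullet> f e) *\<^sub>R e"
proof -
  interpret f: linear f by fact
  let ?K = "V \<inter> sphere 0 1"
  have "compact ?K"
    using closed_subspace[OF V(1)] by (simp add: closed_Int_compact)
  moreover have "(1 / norm y) *\<^sub>R y \<in> ?K"
    using y V(1) by (simp add: subspace_scale)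
  moreover have "continuous_on ?K (\<lambda>x. x \<bullet> f x)"
    using lin by (intro continuous_intros linear_continuous_on) (simp add: linear_conv_bounded_linear)
  ultimately obtain e where e: "e \<in> ?K" and max: "\<And>x. x \<in> ?K \<Longrightarrow> x \<bullet> f x \<le> e \<bullet> f e"
    using continuous_attains_sup[of ?K "\<lambda>x. x \<bullet> f x"] by blast
  define l where "l = e \<bullet> f e"
  define z where "z = f e - l *\<^sub>R e"
  have ee: "e \<bullet> e = 1" and eV: "e \<in> V" using e by (auto simp: norm_eq_1)
  have zV: "z \<in> V"
    unfolding z_def using V eV by (intro subspace_diff subspace_scale) auto
  have quad: "x \<bullet> f x \<le> l * (x \<bullet> x)" if "x \<in> V" for x
  proof (cases "x = 0")
    case False
    then have "(1 / norm x) *\<^sub>R x \<in> ?K"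
      using that V(1) by (simp add: subspace_scale)
    from max[OF this] have "(x \<bullet> f x) / (norm x)\<^sup>2 \<le> l"
      by (simp add: f.scale l_def power2_eq_square)
    then show ?thesis
      using False by (simp add: divide_le_eq dot_square_norm)
  qed (simp add: f.zero)
  have "z \<bullet> z = 0"
  proof (rule ccontr)
    assume "z \<bullet> z \<noteq> 0"
    then have N: "0 < z \<bullet> z" by (simp add: less_le)
    \<comment> \<open>Moving from \<open>e\<close> by \<open>s z\<close> changes \<open>l \<bar>x\<bar>\<^sup>2 - x \<bullet> f x\<close> from \<open>0\<close> to \<open>s\<^sup>2 C - 2 s (z \<bullet> z)\<close>, which is
      negative for the step \<open>s\<close> chosen below.\<close>
    define C where "C = l * (z \<bullet> z) - z \<bullet> f z"
    define s where "s = (z \<bullet> z) / (\<bar>C\<bar> + 1)"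
    have s: "0 < s" using N by (simp add: s_def)
    have zfe: "z \<bullet> f e - l * (z \<bullet> e) = z \<bullet> z"
      by (simp add: z_def inner_diff_right)
    have efz: "e \<bullet> f z = z \<bullet> f e"
      by (metis inner_commute sym)
    have "e + s *\<^sub>R z \<in> V"
      using V(1) eV zV by (intro subspace_add subspace_scale)
    from quad[OF this]
    have "l + s * (2 * (z \<bullet> f e)) + s\<^sup>2 * (z \<bullet> f z) \<le>
        l * (1 + s * (2 * (z \<bullet> e)) + s\<^sup>2 * (z \<bullet> z))"
      by (simp add: f.add f.scale inner_add_left inner_add_right ee efz inner_commute[of e z]
          l_def[symmetric] power2_eq_square algebra_simps)
    then have "2 * s * (z \<bullet> f e - l * (z \<bullet> e)) \<le> s\<^sup>2 * C"
      by (simp add: C_def algebra_simps)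
    then have "s * (2 * (z \<bullet> z)) \<le> s * (s * C)"
      unfolding zfe by (simp add: power2_eq_square algebra_simps)
    then have "2 * (z \<bullet> z) \<le> s * C"
      using s by simp
    also have "s * C \<le> s * (\<bar>C\<bar> + 1)"
      using s by (intro mult_left_mono) auto
    also have "\<dots> = z \<bullet> z"
      by (simp add: s_def)
    finally show False using N by simp
  qed
  then have "f e = (e \<bullet> f e) *\<^sub>R e"
    by (simp add: z_def l_def)
  with e show ?thesis
    by (intro that[of e]) auto
qed

text \<open>
  Take an orthonormal set of eigenvectors of maximal size. Its orthogonal complement is invariant under
  \<open>f\<close>, so if it were nonzero it would contain one more eigenvector.
\<close>

lemma symmetric_linear_eigenbasis:
  fixes f :: "'e::euclidean_space \<Rightarrow> 'e"
  assumes lin: "linear f" and sym: "\<And>x y. x \<bullet> f y = f x \<bullet> y"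
  obtains B where "finite B" "span B = UNIV" "\<And>b. b \<in> B \<Longrightarrow> f b = (b \<bullet> f b) *\<^sub>R b"
    "\<And>b c. b \<in> B \<Longrightarrow> c \<in> B \<Longrightarrow> b \<bullet> c = (if b = c then 1 else 0)"
proof -
  define P where "P B \<longleftrightarrow> (\<forall>b\<in>B. f b = (b \<bullet> f b) *\<^sub>R b) \<and>
    (\<forall>b\<in>B. \<forall>c\<in>B. b \<bullet> c = (if b = c then 1 else 0))" for B
  have ind: "independent B" if "P B" for B
  proof (rule pairwise_orthogonal_independent)
    show "pairwise orthogonal B"
      using that by (auto simp: P_def pairwise_def orthogonal_def)
    show "0 \<notin> B"
      using that unfolding P_def by (metis inner_zero_left zero_neq_one)
  qed
  have "P {}" by (simp add: P_def)
  moreover have "\<forall>B. P B \<longrightarrow> card B < Suc DIM('e)"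
    using ind independent_bound less_Suc_eq_le by blast
  ultimately have "\<exists>B. P B \<and> (\<forall>C. P C \<longrightarrow> card C \<le> card B)"
    by (rule ex_has_greatest_nat)
  then obtain B where B: "P B" and Bmax: "\<And>C. P C \<Longrightarrow> card C \<le> card B"
    by blast
  have fin: "finite B"
    using ind[OF B] independent_bound by blast
  have "span B = UNIV"
  proof (rule ccontr)
    assume "span B \<noteq> UNIV"
    then obtain y where y: "y \<noteq> 0" "\<And>x. x \<in> span B \<Longrightarrow> orthogonal y x"
      using orthogonal_to_subspace_exists_gen[of B UNIV] by auto
    define V where "V = {x. \<forall>b\<in>B. b \<bullet> x = 0}"
    have "subspace V"
      by (auto simp: V_def subspace_def inner_add_right)
    moreover have "f x \<in> V" if "x \<in> V" for x
      unfolding V_def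
    proof safe
      fix b assume b: "b \<in> B"
      have "b \<bullet> f x = ((b \<bullet> f b) *\<^sub>R b) \<bullet> x"
        using sym[of b x] B b unfolding P_def by metis
      then show "b \<bullet> f x = 0"
        using b that by (simp add: V_def)
    qed
    moreover have "y \<in> V"
      using y(2) by (auto simp: V_def orthogonal_def inner_commute span_base)
    ultimately obtain e where e: "e \<in> V" "norm e = 1" "f e = (e \<bullet> f e) *\<^sub>R e"
      using symmetric_linear_has_eigenvector[OF lin sym] y(1) by metis
    have e1: "e \<bullet> e = 1" using e(2) by (simp add: norm_eq_1)
    then have "e \<notin> B" using e(1) by (auto simp: V_def)
    have "P (insert e B)"
      using B e e1 unfolding P_def V_def by (auto simp: inner_commute)
    from Bmax[OF this] show False
      using \<open>e \<notin> B\<close> fin by simp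
  qed
  with B fin show ?thesis
    using that unfolding P_def by blast
qed

text \<open>The root multiplies each vector of an orthonormal eigenbasis by the square root of its eigenvalue.\<close>

lemma positive_linear_sqrt_exists:
  fixes f :: "'e::euclidean_space \<Rightarrow> 'e"
  assumes lin: "linear f" and sym: "\<And>x y. x \<bullet> f y = f x \<bullet> y"
    and pos: "\<And>x. x \<noteq> 0 \<Longrightarrow> 0 < x \<bullet> f x"
  obtains g where "linear g" "\<And>x y. x \<bullet> g y = g x \<bullet> y" "\<And>x. x \<noteq> 0 \<Longrightarrow> 0 < x \<bullet> g x"
    "g \<circ> g = f"
proof -
  obtain B where fin: "finite B" and span: "span B = UNIV"
    and eig: "\<And>b. b \<in> B \<Longrightarrow> f b = (b \<bullet> f b) *\<^sub>R b"
    and ort: "\<And>b c. b \<in> B \<Longrightarrow> c \<in> B \<Longrightarrow> b \<bullet> c = (if b = c then 1 else 0)"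
    using symmetric_linear_eigenbasis[OF lin sym] by blast
  define l where "l b = sqrt (b \<bullet> f b)" for b
  have lpos: "0 < l b" if "b \<in> B" for b
    using pos[of b] ort[OF that that] by (cases "b = 0") (auto simp: l_def)
  define g where "g x = (\<Sum>b\<in>B. (l b * (b \<bullet> x)) *\<^sub>R b)" for x
  have ling: "linear g"
    by (rule linearI)
      (simp_all add: g_def inner_add_right distrib_left scaleR_add_left sum.distrib
        scaleR_sum_right mult.assoc mult.left_commute)
  have xgy: "x \<bullet> g y = (\<Sum>b\<in>B. l b * (b \<bullet> x) * (b \<bullet> y))" for x y
    by (simp add: g_def inner_sum_right inner_commute[of x] mult_ac)
  have gb: "g b = l b *\<^sub>R b" if b: "b \<in> B" for b
  proof -
    have "g b = (\<Sum>c\<in>B. if c = b then l b *\<^sub>R b else 0)"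
      unfolding g_def using b by (intro sum.cong) (auto simp: ort)
    then show ?thesis using b fin by simp
  qed
  have "x \<bullet> g y = g x \<bullet> y" for x y
    by (simp add: xgy inner_commute[of "g x"] mult_ac)
  moreover have "0 < x \<bullet> g x" if x: "x \<noteq> 0" for x
  proof -
    have "\<exists>b\<in>B. b \<bullet> x \<noteq> 0"
    proof (rule ccontr)
      assume "\<not> (\<exists>b\<in>B. b \<bullet> x \<noteq> 0)"
      then have "orthogonal x x"
        using span by (intro orthogonal_to_span[of x B x]) (auto simp: orthogonal_def inner_commute)
      with x show False by (simp add: orthogonal_def)
    qed
    then obtain b where "b \<in> B" "b \<bullet> x \<noteq> 0" by blast
    then show ?thesis
      unfolding xgy mult.assoc using lpos fin
      by (intro sum_pos2[of B b]) (auto simp: less_imp_le zero_less_mult_iff linorder_neq_iff)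
  qed
  moreover have "g \<circ> g = f"
  proof (rule ext)
    fix x
    show "(g \<circ> g) x = f x"
    proof (rule linear_eq_on_span[of "g \<circ> g" f B])
      show "linear (g \<circ> g)" by (rule linear_compose[OF ling ling])
      show "(g \<circ> g) b = f b" if "b \<in> B" for b
      proof -
        have "l b * l b = b \<bullet> f b" using lpos[OF that] by (simp add: l_def)
        then show ?thesis
          using eig[OF that] gb[OF that] by (simp add: linear_scale[OF ling])
      qed
    qed (use span lin in auto)
  qed
  ultimately show ?thesis using ling that by blast
qed

text \<open>
  If \<open>g b = m b\<close> with \<open>m > 0\<close>, then \<open>(h + m) (h b - m b) = 0\<close>. A positive \<open>h\<close> has no eigenvalue
  \<open>- m\<close>, hence \<open>h b = m b\<close>: the two maps agree on an eigenbasis of \<open>g\<close>.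
\<close>

lemma positive_linear_sqrt_unique:
  fixes g h :: "'e::euclidean_space \<Rightarrow> 'e"
  assumes g: "linear g" "\<And>x y. x \<bullet> g y = g x \<bullet> y" "\<And>x. x \<noteq> 0 \<Longrightarrow> 0 < x \<bullet> g x"
    and h: "linear h" "\<And>x. x \<noteq> 0 \<Longrightarrow> 0 < x \<bullet> h x"
    and eq: "g \<circ> g = h \<circ> h"
  shows "g = h"
proof (rule ext)
  fix x
  obtain B where "finite B" and span: "span B = UNIV"
    and eig: "\<And>b. b \<in> B \<Longrightarrow> g b = (b \<bullet> g b) *\<^sub>R b"
    and ort: "\<And>b c. b \<in> B \<Longrightarrow> c \<in> B \<Longrightarrow> b \<bullet> c = (if b = c then 1 else 0)"
    using symmetric_linear_eigenbasis[OF g(1,2)] by blast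
  show "g x = h x"
  proof (rule linear_eq_on_span[OF g(1) h(1)])
    fix b assume b: "b \<in> B"
    define m where "m = b \<bullet> g b"
    define z where "z = h b - m *\<^sub>R b"
    have m: "0 < m" using g(3)[of b] ort[OF b b] by (cases "b = 0") (auto simp: m_def)
    have gb: "g b = m *\<^sub>R b" using eig[OF b] by (simp add: m_def)
    have "h (h b) = g (g b)" using eq by (metis comp_apply)
    also have "\<dots> = m *\<^sub>R m *\<^sub>R b" by (simp add: gb linear_scale[OF g(1)])
    finally have "h z = - m *\<^sub>R z"
      by (simp add: z_def linear_diff[OF h(1)] linear_scale[OF h(1)] algebra_simps)
    then have "z \<bullet> h z \<le> 0" using m by simp
    then have "z = 0" using h(2)[of z] by fastforce
    then show "g b = h b" by (simp add: z_def gb)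
  qed (use span in auto)
qed

lemma pos_def_inner_commute:
  assumes "pos_def A"
  shows "x \<bullet> (A *v y) = (A *v x) \<bullet> y"
  using assms unfolding pos_def_def
  by (metis dot_lmul_matrix vector_transpose_matrix)

lemma pos_def_matrix_sqrt:
  assumes A: "pos_def A"
  shows "pos_def (matrix_sqrt A)" and "matrix_sqrt A ** matrix_sqrt A = A"
proof -
  have "\<exists>!B. pos_def B \<and> B ** B = A"
  proof (rule ex_ex1I)
    obtain g where g: "linear g" "\<And>x y. x \<bullet> g y = g x \<bullet> y" "\<And>x. x \<noteq> 0 \<Longrightarrow> 0 < x \<bullet> g x"
      "g \<circ> g = (*v) A"
      using positive_linear_sqrt_exists[OF matrix_vector_mul_linear[of A]]
        pos_def_inner_commute[OF A] A unfolding pos_def_def by metis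
    define B where "B = matrix g"
    have Bg: "B *v x = g x" for x
      using g(1) by (simp add: B_def matrix_works)
    have "transpose B *v y = B *v y" for y
    proof (rule vector_eq_ldot[THEN iffD1], rule allI)
      fix x
      show "x \<bullet> (transpose B *v y) = x \<bullet> (B *v y)"
        by (metis Bg dot_lmul_matrix g(2) vector_transpose_matrix transpose_transpose)
    qed
    then have "transpose B = B" by (simp add: matrix_eq)
    moreover have "B ** B = A"
      using g(4) by (simp add: matrix_eq matrix_vector_mul_assoc[symmetric] Bg fun_eq_iff)
    ultimately show "\<exists>B. pos_def B \<and> B ** B = A"
      using g(3) by (auto simp: pos_def_def Bg)
  next
    fix B C assume BC: "pos_def B \<and> B ** B = A" "pos_def C \<and> C ** C = A"
    have "(*v) B = (*v) C"
    proof (rule positive_linear_sqrt_unique)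
      show "(*v) B \<circ> (*v) B = (*v) C \<circ> (*v) C"
        using BC by (auto simp: matrix_vector_mul_assoc)
      show "x \<bullet> (B *v y) = (B *v x) \<bullet> y" for x y
        using BC by (blast intro: pos_def_inner_commute)
    qed (use BC in \<open>auto simp: pos_def_def\<close>)
    then show "B = C" by (simp add: matrix_eq fun_eq_iff)
  qed
  from theI'[OF this]
  show "pos_def (matrix_sqrt A)" "matrix_sqrt A ** matrix_sqrt A = A"
    unfolding matrix_sqrt_def by auto
qed

lemma pos_def_mult_matrix_inv:
  assumes "pos_def A"
  shows "A *v (matrix_inv A *v x) = x"
proof -
  have "x = 0" if "A *v x = 0" for x
    using assms that by (metis inner_zero_right less_irrefl pos_def_def)
  then have "\<exists>B. B ** A = mat 1"
    by (simp add: matrix_left_invertible_ker)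
  then have "invertible A"
    unfolding invertible_def by (metis matrix_left_right_inverse)
  then have "A ** matrix_inv A = mat 1"
    unfolding invertible_def matrix_inv_def by (rule someI_ex[THEN conjunct1])
  then show ?thesis
    by (simp add: matrix_vector_mul_assoc)
qed

text \<open>
  With \<open>R\<close> the root of \<open>A\<close>, \<open>y = R\<^sup>-\<^sup>1 u\<close> and \<open>v = A\<^sup>-\<^sup>1 u\<close>, injectivity of \<open>R\<close> gives \<open>R v = y\<close>, and
  symmetry moves \<open>R\<close> across: \<open>y \<bullet> y = y \<bullet> R v = R y \<bullet> v = u \<bullet> v\<close>.
\<close>

lemma norm_matrix_inv_sqrt:
  assumes A: "pos_def A"
  shows "(norm (matrix_inv_sqrt A *v u))\<^sup>2 = u \<bullet> (matrix_inv A *v u)"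
proof -
  define R where "R = matrix_sqrt A"
  have R: "pos_def R" "R ** R = A"
    using pos_def_matrix_sqrt[OF A] by (simp_all add: R_def)
  define y where "y = matrix_inv R *v u"
  define v where "v = matrix_inv A *v u"
  have Ry: "R *v y = u" unfolding y_def by (rule pos_def_mult_matrix_inv[OF R(1)])
  have "A *v v = u" unfolding v_def by (rule pos_def_mult_matrix_inv[OF A])
  then have "R *v (R *v v) = R *v y"
    by (simp add: matrix_vector_mul_assoc R(2) Ry)
  then have "R *v (R *v v - y) = 0" by (simp add: matrix_vector_mult_diff_distrib)
  then have "R *v v - y = 0"
    using R(1) by (metis inner_zero_right less_irrefl pos_def_def)
  then have "y \<bullet> y = y \<bullet> (R *v v)" by simp
  also have "\<dots> = u \<bullet> v" using pos_def_inner_commute[OF R(1)] Ry by simp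
  finally show ?thesis
    by (simp add: matrix_inv_sqrt_def R_def[symmetric] y_def v_def dot_square_norm)
qed

section \<open>One-dimensional marginals of a Gaussian vector\<close>

context prob_space
begin

lemma gaussian_rv_integrable:
  assumes "gaussian_rv M Y"
  shows "integrable M Y" and "integrable M (\<lambda>\<omega>. (Y \<omega>)\<^sup>2)"
proof -
  have [measurable]: "Y \<in> borel_measurable M" using assms by (simp add: gaussian_rv_def)
  consider \<mu> \<sigma> where "0 < \<sigma>" "distributed M lborel Y (normal_density \<mu> \<sigma>)"
    | \<mu> where "AE \<omega> in M. Y \<omega> = \<mu>"
    using assms unfolding gaussian_rv_def by blast
  then have "integrable M Y \<and> integrable M (\<lambda>\<omega>. (Y \<omega>)\<^sup>2)"
  proof cases
    case 1
    have "integrable lborel (\<lambda>x. normal_density \<mu> \<sigma> x * (x - \<mu>)\<^sup>2 +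
        2 * \<mu> * (normal_density \<mu> \<sigma> x * x) - \<mu>\<^sup>2 * normal_density \<mu> \<sigma> x)"
      using 1(1)
      by (intro Bochner_Integration.integrable_add Bochner_Integration.integrable_diff
          integrable_mult_right integrable_normal_moment integrable_normal_moment_nz_1
          integrable_normal_density)
    then have "integrable lborel (\<lambda>x. normal_density \<mu> \<sigma> x * x\<^sup>2)"
      by (rule Bochner_Integration.integrable_cong[THEN iffD1, rotated -1])
        (auto simp: power2_eq_square algebra_simps)
    then show ?thesis
      using distributed_integrable[OF 1(2), of "\<lambda>x. x"] integrable_normal_moment_nz_1[OF 1(1)]
        distributed_integrable[OF 1(2), of "\<lambda>x. x\<^sup>2"] by simp
  next
    case 2
    have "integrable M Y \<longleftrightarrow> integrable M (\<lambda>_. \<mu>)"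
      using 2 by (intro integrable_cong_AE) auto
    moreover have "integrable M (\<lambda>\<omega>. (Y \<omega>)\<^sup>2) \<longleftrightarrow> integrable M (\<lambda>_. \<mu>\<^sup>2)"
      using 2 by (intro integrable_cong_AE) auto
    ultimately show ?thesis by simp
  qed
  then show "integrable M Y" "integrable M (\<lambda>\<omega>. (Y \<omega>)\<^sup>2)" by auto
qed

text \<open>Positive variance excludes the degenerate, almost surely constant case.\<close>

lemma gaussian_rv_standardize:
  assumes Y: "gaussian_rv M Y" and mean: "expectation Y = 0"
    and var: "expectation (\<lambda>\<omega>. (Y \<omega>)\<^sup>2) = s\<^sup>2" and s: "0 < s"
  shows "distributed M lborel (\<lambda>\<omega>. Y \<omega> / s) std_normal_density"
proof -
  have [measurable]: "Y \<in> borel_measurable M" using Y by (simp add: gaussian_rv_def)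
  have nonconst: "\<not> (AE \<omega> in M. Y \<omega> = \<mu>)" for \<mu>
  proof
    assume AE: "AE \<omega> in M. Y \<omega> = \<mu>"
    have "expectation Y = \<mu>"
      using AE integral_cong_AE[of Y M "\<lambda>_. \<mu>"] by (simp add: prob_space)
    with mean AE have "AE \<omega> in M. (Y \<omega>)\<^sup>2 = 0" by simp
    then have "expectation (\<lambda>\<omega>. (Y \<omega>)\<^sup>2) = 0"
      using integral_cong_AE[of "\<lambda>\<omega>. (Y \<omega>)\<^sup>2" M "\<lambda>_. 0"] by simp
    with var s show False by simp
  qed
  then obtain \<mu> \<sigma> where \<sigma>: "0 < \<sigma>" and D: "distributed M lborel Y (normal_density \<mu> \<sigma>)"
    using Y unfolding gaussian_rv_def by blast
  have "\<mu> = 0" using normal_distributed_expectation[OF \<sigma> D] mean by simp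
  moreover have "\<sigma> = s"
    using normal_distributed_variance[OF \<sigma> D] mean var \<sigma> s by simp
  ultimately show ?thesis
    using D normal_standard_normal_convert[OF \<sigma>, of Y \<mu>] by simp
qed

text \<open>The first two moments of \<open>v \<bullet> X\<close> determine its law, since \<open>v \<bullet> X\<close> is Gaussian.\<close>

lemma gaussian_vector_inner_standardize:
  fixes X :: "'a \<Rightarrow> real ^ 'n"
  assumes X: "gaussian_vector M X" and mean: "expectation X = 0"
    and s: "0 < s" "s\<^sup>2 = v \<bullet> (covariance_matrix M X *v v)"
  shows "distributed M lborel (\<lambda>\<omega>. (v \<bullet> X \<omega>) / s) std_normal_density"
proof (rule gaussian_rv_standardize)
  have g: "gaussian_rv M (\<lambda>\<omega>. p \<bullet> X \<omega>)" for p
    using X by (simp add: gaussian_vector_def)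
  show "gaussian_rv M (\<lambda>\<omega>. v \<bullet> X \<omega>)" by (rule g)
  have "integrable M (\<lambda>\<omega>. \<Sum>b\<in>Basis. (b \<bullet> X \<omega>) *\<^sub>R b)"
    using gaussian_rv_integrable(1)[OF g] by (intro Bochner_Integration.integrable_sum) auto
  then have intX: "integrable M X"
    by (simp add: inner_commute[of _ "X _"] euclidean_representation)
  have Ein: "expectation (\<lambda>\<omega>. p \<bullet> X \<omega>) = 0" for p
    using intX mean by (simp add: integral_inner_right)
  show "expectation (\<lambda>\<omega>. v \<bullet> X \<omega>) = 0" by (rule Ein)
  have Ei: "expectation (\<lambda>\<omega>. X \<omega> $ i) = 0" for i
    using Ein[of "axis i 1"] by (simp add: inner_axis')
  have intp: "integrable M (\<lambda>\<omega>. X \<omega> $ i * X \<omega> $ j)" for i j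
  proof -
    \<comment> \<open>Polarization reduces mixed moments to second moments of one-dimensional marginals.\<close>
    have "integrable M (\<lambda>\<omega>. (((axis i 1 + axis j 1) \<bullet> X \<omega>)\<^sup>2 - (axis i 1 \<bullet> X \<omega>)\<^sup>2 - (axis j 1 \<bullet> X \<omega>)\<^sup>2) / 2)"
      by (intro integrable_divide Bochner_Integration.integrable_diff gaussian_rv_integrable(2)[OF g])
    then show ?thesis
      by (simp add: inner_add_left inner_axis' power2_eq_square algebra_simps)
  qed
  have "expectation (\<lambda>\<omega>. (v \<bullet> X \<omega>)\<^sup>2) =
      expectation (\<lambda>\<omega>. \<Sum>i\<in>UNIV. \<Sum>j\<in>UNIV. v $ i * v $ j * (X \<omega> $ i * X \<omega> $ j))"
    by (simp add: inner_vec_def power2_eq_square sum_product mult_ac)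
  also have "\<dots> = (\<Sum>i\<in>UNIV. \<Sum>j\<in>UNIV. v $ i * v $ j * expectation (\<lambda>\<omega>. X \<omega> $ i * X \<omega> $ j))"
    using intp by (simp add: Bochner_Integration.integral_sum)
  also have "\<dots> = s\<^sup>2"
    unfolding s(2)
    by (simp add: inner_vec_def matrix_vector_mult_def covariance_matrix_def Ei sum_distrib_left mult_ac)
  finally show "expectation (\<lambda>\<omega>. (v \<bullet> X \<omega>)\<^sup>2) = s\<^sup>2" .
qed (rule s)

end

section \<open>The standard normal distribution function\<close>

lemma measure_std_normal_Icc:
  assumes "p \<le> q"
  shows "measure std_normal_distribution {p..q} = std_normal_cdf q - std_normal_cdf p"
    and "measure std_normal_distribution {p..q} = integral {p..q} std_normal_density"
proof -
  interpret real_distribution std_normal_distribution by (rule real_dist_normal_dist)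
  have int: "set_integrable lborel {p..q} std_normal_density" for p q
    unfolding set_integrable_def by (intro integrable_mult_indicator) auto
  have eq: "measure std_normal_distribution {p..q} = integral {p..q} std_normal_density" for p q
  proof -
    have "measure std_normal_distribution {p..q} = (LINT x|std_normal_distribution. indicator {p..q} x)"
      by simp
    also have "\<dots> = (LBINT x. std_normal_density x * indicator {p..q} x)"
      by (subst integral_density) auto
    also have "\<dots> = set_lebesgue_integral lborel {p..q} std_normal_density"
      by (simp add: set_lebesgue_integral_def mult.commute)
    also have "\<dots> = integral {p..q} std_normal_density"
      using set_borel_integral_eq_integral(2)[OF int] .
    finally show ?thesis .
  qed
  show "measure std_normal_distribution {p..q} = integral {p..q} std_normal_density"
    by (rule eq)
  have "measure std_normal_distribution {p} = 0"
    using eq[of p p] by simp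
  moreover have "{..q} - {..p} \<union> {p} = {p..q}" using assms by auto
  moreover have "measure std_normal_distribution ({..q} - {..p} \<union> {p}) =
      measure std_normal_distribution ({..q} - {..p}) + measure std_normal_distribution {p}"
    by (intro finite_measure_Union) auto
  moreover have "measure std_normal_distribution ({..q} - {..p}) =
      std_normal_cdf q - std_normal_cdf p"
    unfolding std_normal_cdf_def cdf_def using assms by (intro finite_measure_Diff) auto
  ultimately show "measure std_normal_distribution {p..q} = std_normal_cdf q - std_normal_cdf p"
    by simp
qed

lemma DERIV_std_normal_cdf:
  "(std_normal_cdf has_real_derivative std_normal_density x) (at x)"
proof -
  have cont: "continuous_on A std_normal_density" for A
    unfolding normal_density_def by (intro continuous_intros) auto
  have "((\<lambda>y. integral {x - 1..y} std_normal_density) has_real_derivative std_normal_density x)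
      (at x within {x - 1..x + 1})"
    by (rule integral_has_real_derivative[OF cont]) auto
  then have "((\<lambda>y. std_normal_cdf (x - 1) + integral {x - 1..y} std_normal_density)
      has_real_derivative std_normal_density x) (at x within {x - 1..x + 1})"
    using DERIV_add[OF DERIV_const] by fastforce
  then have "(std_normal_cdf has_real_derivative std_normal_density x)
      (at x within {x - 1..x + 1})"
    unfolding has_field_derivative_def
  proof (rule has_derivative_transform[rotated 2])
    show "std_normal_cdf y = std_normal_cdf (x - 1) + integral {x - 1..y} std_normal_density"
      if "y \<in> {x - 1..x + 1}" for y
      using measure_std_normal_Icc[of "x - 1" y] that by auto
  qed auto
  then show ?thesis
    by (simp add: at_within_Icc_at)
qed

lemma std_normal_cdf_strict_mono: "p < q \<Longrightarrow> std_normal_cdf p < std_normal_cdf q"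
  by (rule DERIV_pos_imp_increasing) (auto intro!: DERIV_std_normal_cdf normal_density_pos)

text \<open>
  This justifies the value of \<open>upper_ratio\<close> at \<open>0\<close>: divided by \<open>a\<close>, numerator and denominator become
  symmetric difference quotients of the normal distribution function, which tend to twice its density
  at \<open>T\<close> and at \<open>0\<close>.
\<close>

lemma upper_ratio_tendsto_0:
  "((\<lambda>a. upper_ratio T (ereal a)) \<longlongrightarrow> upper_ratio T 0) (at_right 0)"
proof -
  have lim: "((\<lambda>a. (std_normal_cdf (T + a) - std_normal_cdf (T - a)) / a)
      \<longlongrightarrow> 2 * std_normal_density T) (at 0)" for T
  proof -
    have "((\<lambda>a. std_normal_cdf (T + a) - std_normal_cdf (T - a))
        has_real_derivative std_normal_density T * 1 - std_normal_density T * (-1)) (at 0)"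
      by (intro DERIV_diff DERIV_chain'[OF _ DERIV_std_normal_cdf[THEN DERIV_cong]])
        (auto intro!: derivative_eq_intros)
    then show ?thesis by (simp add: DERIV_def)
  qed
  have "((\<lambda>a. ((std_normal_cdf (T + a) - std_normal_cdf (T - a)) / a) /
      ((std_normal_cdf (0 + a) - std_normal_cdf (0 - a)) / a))
      \<longlongrightarrow> (2 * std_normal_density T) / (2 * std_normal_density 0)) (at_right 0)"
    by (intro tendsto_divide tendsto_mono[OF _ lim]) (auto simp: at_le std_normal_density_def)
  also have "(2 * std_normal_density T) / (2 * std_normal_density 0) = upper_ratio T 0"
    by (simp add: std_normal_density_def upper_ratio_def)
  finally show ?thesis
    by (rule Lim_transform_eventually)
      (auto simp: upper_ratio_def eventually_at_right_less zero_ereal_def[symmetric]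
        intro!: eventually_mono[OF eventually_at_right_less])
qed

section \<open>Slabs\<close>

definition slab :: "real ^ 'n \<Rightarrow> real \<Rightarrow> real ^ 'n \<Rightarrow> real" where
  "slab v r = indicator {x. \<bar>v \<bullet> x\<bar> \<le> r}"

lemma even_slab: "even_fun (slab v r)"
  by (simp add: even_fun_def slab_def indicator_def)

lemma unimodal_indicator:
  assumes "convex A"
  shows "unimodal (indicator A)"
proof -
  have "{x. indicator A x > c} = (if c < 0 then UNIV else if c < 1 then A else {})" for c :: real
    by (auto simp: indicator_def)
  with assms show ?thesis by (simp add: unimodal_def)
qed

lemma unimodal_slab: "unimodal (slab v r)"
proof -
  have "{x. \<bar>v \<bullet> x\<bar> \<le> r} = {x. v \<bullet> x \<le> r} \<inter> {x. v \<bullet> x \<ge> - r}" by auto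
  then have "convex {x. \<bar>v \<bullet> x\<bar> \<le> r}"
    by (simp add: convex_Int convex_halfspace_le convex_halfspace_ge)
  then show ?thesis unfolding slab_def by (rule unimodal_indicator)
qed

text \<open>The supremum is attained at the point of the slab's boundary on the line through \<open>v\<close>.\<close>

lemma support_fun_slab:
  assumes "v \<noteq> 0" "0 \<le> r"
  shows "support_fun v {x. slab v r x > 0} = ereal r"
  unfolding support_fun_def
proof (rule antisym)
  show "(SUP z\<in>{x. slab v r x > 0}. ereal (z \<bullet> v)) \<le> ereal r"
    by (rule SUP_least) (auto simp: slab_def indicator_def inner_commute split: if_splits)
  have "(r / (v \<bullet> v)) *\<^sub>R v \<in> {x. slab v r x > 0}"
    using assms by (simp add: slab_def)
  moreover have "ereal r = ereal (((r / (v \<bullet> v)) *\<^sub>R v) \<bullet> v)"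
    using assms by simp
  ultimately show "ereal r \<le> (SUP z\<in>{x. slab v r x > 0}. ereal (z \<bullet> v))"
    by (rule SUP_upper2[OF _ eq_refl])
qed

lemma support_fun_UNIV:
  assumes "v \<noteq> 0"
  shows "support_fun v UNIV = \<infinity>"
proof (rule ereal_top)
  fix B
  have "ereal B \<le> ereal (((B / (v \<bullet> v)) *\<^sub>R v) \<bullet> v)" using assms by simp
  then show "ereal B \<le> support_fun v UNIV"
    unfolding support_fun_def by (rule SUP_upper2[OF UNIV_I])
qed

lemma expect_eq_expectation:
  "f \<in> borel_measurable M \<Longrightarrow> expect M f = (LINT \<omega>|M. f \<omega>)"
  by (simp add: expect_def integral_completion)

text \<open>
  \<open>X - y\<close> lies in the slab exactly when \<open>(v \<bullet> X) / s\<close> lies within distance \<open>a\<close> of \<open>(v \<bullet> y) / s\<close>: the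
  expectation is the probability that a standard normal variable falls into an interval.
\<close>

lemma expect_slab_shift:
  assumes "prob_space M" and [measurable]: "X \<in> borel_measurable M"
    and D: "distributed M lborel (\<lambda>\<omega>. (v \<bullet> X \<omega>) / s) std_normal_density"
    and s: "0 < s" and a: "0 \<le> a"
  shows "expect M (\<lambda>\<omega>. slab v (a * s) (X \<omega> - y)) =
    std_normal_cdf ((v \<bullet> y) / s + a) - std_normal_cdf ((v \<bullet> y) / s - a)"
proof -
  interpret prob_space M by fact
  let ?Y = "\<lambda>\<omega>. (v \<bullet> X \<omega>) / s" and ?I = "{(v \<bullet> y) / s - a..(v \<bullet> y) / s + a}"
  have I: "?Y \<omega> \<in> ?I \<longleftrightarrow> \<bar>v \<bullet> (X \<omega> - y)\<bar> \<le> a * s" for \<omega>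
  proof -
    have "?Y \<omega> \<in> ?I \<longleftrightarrow> \<bar>(v \<bullet> (X \<omega> - y)) / s\<bar> \<le> a"
      by (auto simp: inner_diff_right diff_divide_distrib abs_le_iff)
    then show ?thesis
      using s by (simp add: abs_divide pos_divide_le_eq)
  qed
  have "(\<lambda>\<omega>. slab v (a * s) (X \<omega> - y)) = (\<lambda>\<omega>. indicator ?I (?Y \<omega>))"
    unfolding slab_def by (auto simp: indicator_def I simp del: atLeastAtMost_iff)
  then have "expect M (\<lambda>\<omega>. slab v (a * s) (X \<omega> - y)) = (LINT \<omega>|M. indicator ?I (?Y \<omega>))"
    by (simp add: expect_eq_expectation)
  also have "\<dots> = (LINT z|distr M lborel ?Y. indicator ?I z)"
    by (subst integral_distr) auto
  also have "\<dots> = measure std_normal_distribution ?I"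
    by (simp add: distributed_distr_eq_density[OF D])
  also have "\<dots> = std_normal_cdf ((v \<bullet> y) / s + a) - std_normal_cdf ((v \<bullet> y) / s - a)"
    using a by (intro measure_std_normal_Icc) auto
  finally show ?thesis .
qed

theorem proposition2p5:
  fixes M :: "'a measure" and X :: "'a \<Rightarrow> real ^ 'n" and S :: "real ^ 'n ^ 'n"
    and u :: "real ^ 'n" and t :: real
  assumes "prob_space M"
    and "gaussian_vector M X"
    and "(LINT \<omega>|M. X \<omega>) = 0"
    and "covariance_matrix M X = S"
    and "pos_def S"
    and "norm u = 1"
    and "0 \<le> t"
  shows
    "(\<forall>c > exp (- (t\<^sup>2 * (u \<bullet> (matrix_inv S *v u))) / 2).
        \<not> (\<forall>w. admissible M X w \<longrightarrow> c \<le> shift_ratio M X w u t)) \<and>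
     (\<forall>a::ereal. 0 < a \<longrightarrow>
        (\<exists>w. admissible M X w \<and> half_width S w u = a \<and>
           shift_ratio M X w u t
             = upper_ratio (t * norm (matrix_inv_sqrt S *v u)) (half_width S w u))) \<and>
     (\<exists>W :: nat \<Rightarrow> real ^ 'n \<Rightarrow> real.
        (\<forall>k. admissible M X (W k) \<and>
           shift_ratio M X (W k) u t
             = upper_ratio (t * norm (matrix_inv_sqrt S *v u)) (half_width S (W k) u)) \<and>
        (\<lambda>k. half_width S (W k) u) \<longlonglongrightarrow> 0 \<and>
        (\<lambda>k. shift_ratio M X (W k) u t)
          \<longlonglongrightarrow> upper_ratio (t * norm (matrix_inv_sqrt S *v u)) 0)"
proof -
  interpret prob_space M by fact
  define v where "v = matrix_inv S *v u"
  define s where "s = norm (matrix_inv_sqrt S *v u)"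
  have Sv: "S *v v = u" unfolding v_def by (rule pos_def_mult_matrix_inv) fact
  have v: "v \<noteq> 0" using Sv \<open>norm u = 1\<close> by auto
  have s2: "s\<^sup>2 = u \<bullet> v" unfolding s_def v_def by (rule norm_matrix_inv_sqrt) fact
  have "0 < v \<bullet> (S *v v)" using \<open>pos_def S\<close> v by (simp add: pos_def_def)
  then have "0 < s\<^sup>2" by (simp add: s2 Sv inner_commute[of u])
  then have s: "0 < s"
    using norm_ge_zero[of "matrix_inv_sqrt S *v u", folded s_def] by (cases "s = 0") auto
  have [measurable]: "X \<in> borel_measurable M"
    using \<open>gaussian_vector M X\<close> by (simp add: gaussian_vector_def)
  have D: "distributed M lborel (\<lambda>\<omega>. (v \<bullet> X \<omega>) / s) std_normal_density"
    by (rule gaussian_vector_inner_standardize[OF assms(2,3) s])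
      (simp add: s2 assms(4) Sv inner_commute[of u])
  have vtu: "(v \<bullet> (t *\<^sub>R u)) / s = t * s"
    using s by (simp add: inner_commute[of v] s2[symmetric] power2_eq_square)
  note E = expect_slab_shift[OF \<open>prob_space M\<close> _ D s]
  have slab: "admissible M X (slab v (a * s)) \<and> half_width S (slab v (a * s)) u = ereal a \<and>
      shift_ratio M X (slab v (a * s)) u t = upper_ratio (t * s) (ereal a)" if a: "0 < a" for a
  proof -
    have E0: "expect M (\<lambda>\<omega>. slab v (a * s) (X \<omega>)) = std_normal_cdf a - std_normal_cdf (- a)"
      using E[of a 0] a by simp
    then have "admissible M X (slab v (a * s))"
      using a std_normal_cdf_strict_mono[of "- a" a]
      by (auto simp: admissible_def even_slab unimodal_slab) (simp add: slab_def)
    moreover have "half_width S (slab v (a * s)) u = ereal a"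
      using a s v by (simp add: half_width_def v_def[symmetric] s_def[symmetric] support_fun_slab)
    moreover have "shift_ratio M X (slab v (a * s)) u t = upper_ratio (t * s) (ereal a)"
      using E[of a "t *\<^sub>R u"] a unfolding vtu
      by (simp add: shift_ratio_def E0 upper_ratio_def)
    ultimately show ?thesis by blast
  qed
  have full: "admissible M X (\<lambda>_. 1) \<and> half_width S (\<lambda>_. 1) u = \<infinity> \<and>
      shift_ratio M X (\<lambda>_. 1) u t = upper_ratio (t * s) \<infinity>"
  proof -
    have E1: "expect M (\<lambda>_. 1) = 1"
      by (simp add: expect_eq_expectation prob_space)
    moreover have "unimodal (\<lambda>_::real^'n. 1)"
      using unimodal_indicator[of "UNIV :: (real ^ 'n) set"] by simp
    moreover have "half_width S (\<lambda>_. 1) u = \<infinity>"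
      using s by (simp add: half_width_def v_def[symmetric] s_def[symmetric] support_fun_UNIV[OF v])
    ultimately show ?thesis
      by (simp add: admissible_def even_fun_def shift_ratio_def upper_ratio_def)
  qed
  \<comment> \<open>Thin slabs serve both the limit at half-width \<open>0\<close> and the sharpness of the lower bound.\<close>
  define a where "a k = 1 / real (Suc k)" for k
  define W where "W k = slab v (a k * s)" for k
  have a: "0 < a k" for k by (simp add: a_def)
  note W = slab[OF a, folded W_def]
  have a0: "a \<longlonglongrightarrow> 0"
    unfolding a_def using LIMSEQ_inverse_real_of_nat by (simp add: inverse_eq_divide)
  have "filterlim a (at_right 0) sequentially"
    using a a0 by (intro tendsto_imp_filterlim_at_right always_eventually) auto
  from filterlim_compose[OF upper_ratio_tendsto_0 this]
  have lim: "(\<lambda>k. shift_ratio M X (W k) u t) \<longlonglongrightarrow> upper_ratio (t * s) 0"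
    using W by simp
  have "\<exists>w. admissible M X w \<and> shift_ratio M X w u t < c"
    if c: "exp (- (t\<^sup>2 * (u \<bullet> (matrix_inv S *v u))) / 2) < c" for c
  proof -
    have "upper_ratio (t * s) 0 < c"
      using c by (simp add: upper_ratio_def power_mult_distrib s2 v_def)
    from order_tendstoD(2)[OF lim this] obtain k where "shift_ratio M X (W k) u t < c"
      by (auto simp: eventually_sequentially)
    with W[of k] show ?thesis by blast
  qed
  then have "\<forall>c > exp (- (t\<^sup>2 * (u \<bullet> (matrix_inv S *v u))) / 2).
      \<not> (\<forall>w. admissible M X w \<longrightarrow> c \<le> shift_ratio M X w u t)"
    by (meson not_less)
  moreover have "\<exists>w. admissible M X w \<and> half_width S w u = a \<and>
      shift_ratio M X w u t = upper_ratio (t * s) (half_width S w u)" if "0 < a" for a :: ereal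
    using that
  proof (cases a)
    case (real r)
    then show ?thesis using slab[of r] that by auto
  next
    case PInf
    then show ?thesis using full by auto
  qed auto
  moreover have "(\<lambda>k. half_width S (W k) u) \<longlonglongrightarrow> 0"
    using W a0 by (simp add: zero_ereal_def)
  ultimately show ?thesis
    unfolding s_def[symmetric] using W lim
    by (intro conjI exI[of _ W]) simp_all
qed

end
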